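(* Let $V$ be a finite-dimensional vector space over the finite field $\mathbb{F}_q$ and let $\mathcal{L}(V)$ be the lattice of subspaces of $V$. The function $d_{\mathfrak{N}}:\mathcal{L}(V)\times\mathcal{L}(V)\to\mathbb{R}$ defined by $d_{\mathfrak{N}}(S,T)=\mathfrak{N}(S)+\mathfrak{N}(T)-2\,\mathfrak{N}(S\cap T)$ is a metric on $\mathcal{L}(V)$.
   Context: An atom is a one-dimensional subspace of $V$. For a subspace $S\subseteq V$, a set of atoms $\{A_1,\dots,A_k\}$ is an atomic decomposition of $S$ if $A_1+\cdots+A_k=S$. It is minimal if no proper subset of it is an atomic decomposition of $S$. $\mathfrak{N}(S)$ denotes the number of minimal atomic decompositions of $S$. *)

theory Defs
  imports "HOL-Analysis.Abstract_Metric_Spaces" "HOL-Library.Set_Algebras"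
begin

definition (in vector_space) subspace_lattice :: "'b set set"
  where "subspace_lattice = {S. subspace S}"

definition (in vector_space) atom :: "'b set \<Rightarrow> bool"
  where "atom A \<longleftrightarrow> subspace A \<and> dim A = 1"

text \<open>The sum of the subspaces in \<open>D\<close> is the elementwise sum of sets.
  A decomposition \<open>{A\<^sub>1, \<dots>, A\<^sub>k}\<close> has \<open>k \<ge> 1\<close>, so the zero subspace has none.
  If the empty set counted as a decomposition of the zero subspace, then the zero
  subspace and every atom would each have exactly one minimal decomposition,
  and the function \<open>atomic_dist\<close> below would not separate them.\<close>

definition (in vector_space) atomic_decomposition :: "'b set \<Rightarrow> 'b set set \<Rightarrow> bool"
  where "atomic_decomposition S D \<longleftrightarrow>
    finite D \<and> D \<noteq> {} \<and> (\<forall>A\<in>D. atom A) \<and> (\<Sum>A\<in>D. A) = S"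

definition (in vector_space) minimal_atomic_decomposition :: "'b set \<Rightarrow> 'b set set \<Rightarrow> bool"
  where "minimal_atomic_decomposition S D \<longleftrightarrow>
    atomic_decomposition S D \<and> (\<forall>D'. D' \<subset> D \<longrightarrow> \<not> atomic_decomposition S D')"

definition (in vector_space) num_minimal_decompositions :: "'b set \<Rightarrow> nat"
  where "num_minimal_decompositions S = card {D. minimal_atomic_decomposition S D}"

text \<open>The function is only meant on pairs of subspaces. It is extended by \<open>0\<close> because
  \<^locale>\<open>Metric_space\<close> asks for nonnegativity and symmetry on the whole type.\<close>

definition (in vector_space) atomic_dist :: "'b set \<Rightarrow> 'b set \<Rightarrow> real"
  where "atomic_dist S T =
    (if S \<in> subspace_lattice \<and> T \<in> subspace_lattice
     then real (num_minimal_decompositions S) + real (num_minimal_decompositions T)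
            - 2 * real (num_minimal_decompositions (S \<inter> T))
     else 0)"

end

theory Submission
  imports Defs
begin

text \<open>Write \<open>N S\<close> for the number of minimal atomic decompositions of \<open>S\<close>. Everything rests on
  one growth property: \<open>N\<close> at least doubles from a subspace to any strictly larger one
  (\<open>num_minimal_decompositions_doubles\<close>), and it is positive away from the zero subspace.

  Definiteness follows, since \<open>N\<close> is then strictly increasing along inclusion. For the triangle
  inequality between \<open>S\<close>, \<open>T\<close>, \<open>U\<close> one has to show
  \<open>N (S \<inter> T) + N (T \<inter> U) \<le> N T + N (S \<inter> U)\<close>. If one of \<open>P = S \<inter> T\<close> and \<open>Q = T \<inter> U\<close> contains the
  other, the smaller one lies in \<open>S \<inter> U\<close> and the larger one in \<open>T\<close>. Otherwise both are proper
  subspaces of \<open>T\<close>, so each of \<open>N P\<close> and \<open>N Q\<close> is at most half of \<open>N T\<close>.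

  For the doubling, a decomposition is minimal exactly when its number of atoms is the dimension
  of the subspace (\<open>minimal_atomic_decomposition_iff_card\<close>); in other words, minimal
  decompositions are the sets of lines spanned by the vectors of a basis. Given nonzero \<open>S \<subset> T\<close>,
  a basis of \<open>S\<close> extended by \<open>C\<close> to a basis of \<open>T\<close> provides a set \<open>E\<close> of lines that turns every
  minimal decomposition \<open>D\<close> of \<open>S\<close> into a minimal decomposition \<open>D \<union> E\<close> of \<open>T\<close>. Replacing some
  \<open>c \<in> C\<close> by \<open>c + a\<close>, where \<open>a \<in> S\<close> is nonzero, provides a second such set. Both \<open>D\<close> and \<open>E\<close>
  can be read off from \<open>D \<union> E\<close>, because the lines of \<open>D\<close> are those contained in \<open>S\<close>.\<close>

context finite_dimensional_vector_space
begin

section \<open>Atoms and their sums\<close>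

lemma sum_subspaces_eq_span:
  assumes "finite D" "\<forall>A\<in>D. subspace A"
  shows "(\<Sum>A\<in>D. A) = span (\<Union>D)"
  using assms
proof (induction D rule: finite_induct)
  case empty
  then show ?case by (simp add: set_zero)
next
  case (insert A D)
  have "(\<Sum>A\<in>insert A D. A) = A + span (\<Union>D)"
    using insert by simp
  also have "\<dots> = span (A \<union> \<Union>D)"
    using insert.prems by (auto simp: span_Un set_plus_def span_eq_iff[THEN iffD2])
  finally show ?case by simp
qed

lemma atom_iff_line: "atom A \<longleftrightarrow> (\<exists>v. v \<noteq> 0 \<and> A = span {v})"
proof
  assume A: "atom A"
  then obtain B where B: "B \<subseteq> A" "independent B" "A \<subseteq> span B" "card B = dim A"
    using basis_exists by blast
  moreover obtain v where "B = {v}"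
    using A B(4) by (auto simp: atom_def card_1_singleton_iff)
  moreover have "span B = A"
    using A B by (metis atom_def span_minimal subset_antisym)
  ultimately show "\<exists>v. v \<noteq> 0 \<and> A = span {v}" by auto
next
  assume "\<exists>v. v \<noteq> 0 \<and> A = span {v}"
  then show "atom A"
    by (auto simp: atom_def dim_eq_card_independent)
qed

lemma span_Union_lines: "span (\<Union>v\<in>B. span {v}) = span B"
proof (rule span_unique[symmetric])
  show "B \<subseteq> span (\<Union>v\<in>B. span {v})"
    by (auto intro!: span_base)
  show "span (\<Union>v\<in>B. span {v}) \<subseteq> W" if "B \<subseteq> W" "subspace W" for W
    using that by (intro span_minimal) (auto dest: span_minimal[of "{_}" W, THEN subsetD, rotated 2])
qed simp

lemma atoms_obtain_representatives:
  assumes "\<forall>A\<in>D. atom A"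
  obtains r where "\<And>A. A \<in> D \<Longrightarrow> r A \<noteq> 0" "\<And>A. A \<in> D \<Longrightarrow> span {r A} = A"
    "span (r ` D) = span (\<Union>D)"
proof -
  obtain r where r: "\<And>A. A \<in> D \<Longrightarrow> r A \<noteq> 0" "\<And>A. A \<in> D \<Longrightarrow> span {r A} = A"
    using assms unfolding atom_iff_line by metis
  have "span (r ` D) = span (\<Union>v\<in>r ` D. span {v})"
    by (rule span_Union_lines[symmetric])
  also have "(\<Union>v\<in>r ` D. span {v}) = \<Union>D"
    using r(2) by auto
  finally show thesis using that[of r] r by blast
qed

lemma dim_span_atoms_le_card:
  assumes "finite D" "\<forall>A\<in>D. atom A"
  shows "dim (span (\<Union>D)) \<le> card D"
proof -
  obtain r where r: "span (r ` D) = span (\<Union>D)"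
    using atoms_obtain_representatives[OF assms(2)] by metis
  have "dim (span (\<Union>D)) \<le> card (r ` D)"
    by (rule dim_le_card) (use r assms(1) in auto)
  then show ?thesis
    using card_image_le[OF assms(1), of r] by linarith
qed

lemma atomic_decomposition_iff_span:
  "atomic_decomposition S D \<longleftrightarrow>
    finite D \<and> D \<noteq> {} \<and> (\<forall>A\<in>D. atom A) \<and> span (\<Union>D) = S"
proof (cases "finite D \<and> (\<forall>A\<in>D. atom A)")
  case True
  then have "(\<Sum>A\<in>D. A) = span (\<Union>D)"
    by (intro sum_subspaces_eq_span) (simp_all add: atom_def)
  with True show ?thesis
    unfolding atomic_decomposition_def by simp
next
  case False
  then show ?thesis
    unfolding atomic_decomposition_def by blast
qed

section \<open>Minimal decompositions are bases up to scaling\<close>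

text \<open>Vectors representing the atoms of a decomposition span the subspace and therefore contain a
  basis of it, whose lines form a decomposition with as many atoms as the dimension. So a minimal
  decomposition has no further atoms; conversely fewer atoms than the dimension cannot suffice.\<close>

lemma minimal_atomic_decomposition_iff_card:
  "minimal_atomic_decomposition S D \<longleftrightarrow> atomic_decomposition S D \<and> card D = dim S"
proof (intro iffI conjI)
  assume min: "minimal_atomic_decomposition S D"
  then show dec: "atomic_decomposition S D"
    by (simp add: minimal_atomic_decomposition_def)
  then have D: "finite D" "D \<noteq> {}" "\<forall>A\<in>D. atom A" "span (\<Union>D) = S"
    by (auto simp: atomic_decomposition_iff_span)
  obtain r where r: "\<And>A. A \<in> D \<Longrightarrow> r A \<noteq> 0" "\<And>A. A \<in> D \<Longrightarrow> span {r A} = A"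
    and r_span: "span (r ` D) = span (\<Union>D)"
    using atoms_obtain_representatives[OF D(3)] by metis
  obtain B where B: "B \<subseteq> r ` D" "independent B" "r ` D \<subseteq> span B"
    using maximal_independent_subset[of "r ` D"] by blast
  have B_span: "span B = S"
    using B r_span D(4) by (metis span_mono span_span subset_antisym)
  let ?E = "(\<lambda>v. span {v}) ` B"
  have E_sub: "?E \<subseteq> D"
    using B(1) r(2) by auto
  have B_ne: "B \<noteq> {}"
    using B(3) r(1) D(2) by auto
  have "atomic_decomposition S ?E"
    unfolding atomic_decomposition_iff_span span_Union_lines
    using E_sub D B_ne B_span by (auto intro: finite_subset)
  then have "?E = D"
    using min E_sub unfolding minimal_atomic_decomposition_def by blast
  then have "card D \<le> card B"
    using card_image_le[of B "\<lambda>v. span {v}"] finiteI_independent[OF B(2)] by simp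
  also have "card B = dim S"
    using B_span dim_span_eq_card_independent[OF B(2)] by simp
  finally have "card D \<le> dim S" .
  moreover have "dim S \<le> card D"
    using dim_span_atoms_le_card[OF D(1,3)] D(4) by simp
  ultimately show "card D = dim S" by simp
next
  assume D: "atomic_decomposition S D \<and> card D = dim S"
  have "\<not> atomic_decomposition S D'" if "D' \<subset> D" for D'
  proof
    assume "atomic_decomposition S D'"
    then have "dim S \<le> card D'"
      using dim_span_atoms_le_card[of D'] by (auto simp: atomic_decomposition_iff_span)
    moreover have "card D' < card D"
      using that D by (intro psubset_card_mono) (simp_all add: atomic_decomposition_def)
    ultimately show False using D by simp
  qed
  then show "minimal_atomic_decomposition S D"
    using D by (simp add: minimal_atomic_decomposition_def)
qed

lemma minimal_atomic_decomposition_exists: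
  assumes "subspace S" "S \<noteq> {0}"
  shows "\<exists>D. minimal_atomic_decomposition S D"
proof -
  obtain B where B: "B \<subseteq> S" "independent B" "S \<subseteq> span B" "card B = dim S"
    using basis_exists by blast
  have B_span: "span B = S"
    using B assms(1) by (metis span_minimal subset_antisym)
  have B_ne: "B \<noteq> {}"
    using B_span assms(2) by auto
  have nonzero: "v \<noteq> 0" if "v \<in> B" for v
    using B(2) that dependent_zero by blast
  have fin: "finite B" using B(2) by (rule finiteI_independent)
  let ?D = "(\<lambda>v. span {v}) ` B"
  have dec: "atomic_decomposition S ?D"
    unfolding atomic_decomposition_iff_span span_Union_lines
    using fin B_ne B_span nonzero by (auto simp: atom_iff_line)
  have "dim S \<le> card ?D"
    using dec dim_span_atoms_le_card[of ?D] by (auto simp: atomic_decomposition_iff_span)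
  moreover have "card ?D \<le> dim S"
    using card_image_le[OF fin] B(4) by metis
  ultimately show ?thesis
    using dec unfolding minimal_atomic_decomposition_iff_card by (metis le_antisym)
qed

lemma no_minimal_atomic_decomposition_zero: "\<not> minimal_atomic_decomposition {0} D"
proof
  assume "minimal_atomic_decomposition {0} D"
  then have "card D = dim {0}" "finite D" "D \<noteq> {}"
    unfolding minimal_atomic_decomposition_iff_card atomic_decomposition_def by blast+
  moreover have "dim {0} = 0"
    using dim_le_card[of "{0}" "{}"] by simp
  ultimately show False by simp
qed

end

section \<open>Extending decompositions to a larger subspace\<close>

text \<open>A frame of a linear complement of \<open>S\<close> in \<open>T\<close>. An upper bound on the number of atoms is
  enough, because the spanning condition gives the reverse inequality.\<close>

definition (in vector_space) complementary_atoms :: "'b set \<Rightarrow> 'b set \<Rightarrow> 'b set set \<Rightarrow> bool"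
  where "complementary_atoms S T E \<longleftrightarrow>
    finite E \<and> (\<forall>A\<in>E. atom A \<and> \<not> A \<subseteq> S) \<and> span (S \<union> \<Union>E) = T \<and> card E + dim S \<le> dim T"

context finite_dimensional_vector_space
begin

lemma minimal_atomic_decomposition_extend:
  assumes D: "minimal_atomic_decomposition S D" and E: "complementary_atoms S T E"
  shows "minimal_atomic_decomposition T (D \<union> E)"
proof -
  have D': "finite D" "D \<noteq> {}" "\<forall>A\<in>D. atom A" "span (\<Union>D) = S" "card D = dim S"
    using D by (auto simp: minimal_atomic_decomposition_iff_card atomic_decomposition_iff_span)
  have E': "finite E" "\<forall>A\<in>E. atom A" "span (S \<union> \<Union>E) = T" "card E + dim S \<le> dim T"
    using E by (auto simp: complementary_atoms_def)
  have "span (\<Union>(D \<union> E)) = span (span (\<Union>D) \<union> \<Union>E)"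
    by (simp add: span_Un span_span)
  also have "\<dots> = T" using D'(4) E'(3) by simp
  finally have span: "span (\<Union>(D \<union> E)) = T" .
  then have "dim T \<le> card (D \<union> E)"
    using dim_span_atoms_le_card[of "D \<union> E"] D' E' by auto
  moreover have "card (D \<union> E) \<le> dim T"
    using card_Un_le[of D E] D'(5) E'(4) by linarith
  ultimately show ?thesis
    using span D' E' by (auto simp: minimal_atomic_decomposition_iff_card atomic_decomposition_iff_span)
qed

text \<open>This recovers both parts of an extended decomposition from their union, which makes the
  extension injective in the decomposition and in the complementary set together.\<close>

lemma extension_determines_parts:
  assumes "minimal_atomic_decomposition S D" "complementary_atoms S T E"
  shows "{A \<in> D \<union> E. A \<subseteq> S} = D" "{A \<in> D \<union> E. \<not> A \<subseteq> S} = E"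
proof -
  have "A \<subseteq> S" if "A \<in> D" for A
    using assms(1) that span_superset[of "\<Union>D"]
    by (auto simp: minimal_atomic_decomposition_def atomic_decomposition_iff_span)
  then show "{A \<in> D \<union> E. A \<subseteq> S} = D" "{A \<in> D \<union> E. \<not> A \<subseteq> S} = E"
    using assms(2) by (auto simp: complementary_atoms_def)
qed

lemma complementary_atoms_lines:
  assumes "finite C" "\<forall>v\<in>C. v \<notin> S" "subspace S" "span (S \<union> C) = T" "card C + dim S \<le> dim T"
  shows "complementary_atoms S T ((\<lambda>v. span {v}) ` C)"
proof -
  have "span (S \<union> (\<Union>v\<in>C. span {v})) = span (S \<union> C)"
    by (simp add: span_Un[of S] span_Union_lines)
  moreover have "card ((\<lambda>v. span {v}) ` C) \<le> card C"
    using assms(1) by (rule card_image_le)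
  moreover have "v \<noteq> 0" if "v \<in> C" for v
    using assms(2,3) that subspace_0 by blast
  moreover have "\<not> span {v} \<subseteq> S" if "v \<in> C" for v
    using assms(2) that span_base[of v "{v}"] by blast
  ultimately show ?thesis
    using assms unfolding complementary_atoms_def atom_iff_line by auto
qed

text \<open>A complement of a nonzero proper subspace is never unique: any vector of it may be sheared by
  a nonzero vector of the subspace.\<close>

lemma two_complementary_sets_of_atoms:
  assumes S: "subspace S" "S \<noteq> {0}" and T: "subspace T" and "S \<subset> T"
  obtains E1 E2 where "complementary_atoms S T E1" "complementary_atoms S T E2" "E1 \<noteq> E2"
proof -
  obtain B where B: "B \<subseteq> S" "independent B" "S \<subseteq> span B" "card B = dim S"
    using basis_exists by blast
  have B_span: "span B = S"
    using B S(1) by (metis span_minimal subset_antisym)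
  obtain B' where B': "B \<subseteq> B'" "B' \<subseteq> T" "independent B'" "T \<subseteq> span B'"
    using maximal_independent_subset_extend[of B T] B(1,2) \<open>S \<subset> T\<close> by blast
  have B'_span: "span B' = T"
    using B' T by (metis span_minimal subset_antisym)
  have fin: "finite B'" using B'(3) by (rule finiteI_independent)
  define C where "C = B' - B"
  have card_C: "card C + dim S = dim T"
    using B'(1,3) B'_span B(4) fin card_mono[OF fin B'(1)] dim_span_eq_card_independent[OF B'(3)]
    by (simp add: C_def card_Diff_subset finite_subset)
  have C_notin: "v \<notin> S" if "v \<in> C" for v
  proof
    assume "v \<in> S"
    then have "v \<in> span (B' - {v})"
      using B_span span_mono[of B "B' - {v}"] B'(1) that by (auto simp: C_def)
    then show False using B'(3) that by (auto simp: C_def dependent_def)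
  qed
  have finC: "finite C" using fin by (simp add: C_def)
  have "span (S \<union> C) = span (B \<union> C)"
    unfolding B_span[symmetric] by (simp add: span_Un span_span)
  also have "\<dots> = T"
    using B'(1) B'_span by (simp add: C_def Un_absorb1)
  finally have SC: "span (S \<union> C) = T" .
  obtain c where c: "c \<in> C"
  proof -
    have "\<not> B' \<subseteq> B"
      using B_span B'_span \<open>S \<subset> T\<close> span_mono[of B' B] by blast
    then show ?thesis using that unfolding C_def by blast
  qed
  obtain a where a: "a \<in> B"
    using B_span S(2) by fastforce
  have a_S: "a \<in> S" using a B(1) by blast
  \<comment> \<open>Shearing \<open>c\<close> by \<open>a\<close> gives another complement of \<open>S\<close>;
    no vector of \<open>C\<close> spans the line of \<open>c + a\<close>.\<close>
  let ?C' = "insert (c + a) (C - {c})"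
  have ca: "c + a \<notin> S"
    using C_notin[OF c] a_S S(1) by (metis add_diff_cancel_right' subspace_diff)
  have "span (S \<union> ?C') = T"
  proof (rule subset_antisym)
    have "c + a \<in> T"
      using c a_S \<open>S \<subset> T\<close> B'(2) T by (auto simp: C_def intro: subspace_add)
    then show "span (S \<union> ?C') \<subseteq> T"
      using \<open>S \<subset> T\<close> B'(2) T by (intro span_minimal) (auto simp: C_def)
    have "(c + a) - a \<in> span (S \<union> ?C')"
      by (intro span_diff span_base) (use a_S in auto)
    then have "c \<in> span (S \<union> ?C')" by simp
    then have "S \<union> C \<subseteq> span (S \<union> ?C')"
      by (auto intro: span_base)
    then show "T \<subseteq> span (S \<union> ?C')"
      using SC by (metis span_minimal subspace_span)
  qed
  moreover have "card ?C' \<le> card C"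
    using c finC by (intro card_insert_le_m1) (auto simp: card_gt_0_iff)
  ultimately have E2: "complementary_atoms S T ((\<lambda>v. span {v}) ` ?C')"
    using C_notin ca S(1) fin card_C by (intro complementary_atoms_lines) (auto simp: C_def)
  have E1: "complementary_atoms S T ((\<lambda>v. span {v}) ` C)"
    using C_notin S(1) fin card_C SC by (intro complementary_atoms_lines) (auto simp: C_def)
  have "span {c + a} \<noteq> span {x}" if x: "x \<in> C" for x
  proof
    assume "span {c + a} = span {x}"
    then have in_x: "c + a \<in> span {x}" using span_base[of "c + a" "{c + a}"] by simp
    have ne: "a \<noteq> c" using a c by (auto simp: C_def)
    show False
    proof (cases "x = c")
      case True
      then have "c + a - c \<in> span {c}"
        using in_x by (intro span_diff) (auto intro: span_base)
      then have "a \<in> span (B' - {a})"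
        using span_mono[of "{c}" "B' - {a}"] c ne by (auto simp: C_def)
      then show False using B'(1,3) a by (auto simp: dependent_def)
    next
      case False
      then have "c + a \<in> span (B' - {c})"
        using in_x span_mono[of "{x}" "B' - {c}"] x by (auto simp: C_def)
      moreover have "a \<in> span (B' - {c})"
        using a B'(1) ne by (intro span_base) auto
      ultimately have "c + a - a \<in> span (B' - {c})"
        by (rule span_diff)
      then show False using B'(3) c by (auto simp: C_def dependent_def)
    qed
  qed
  then have "(\<lambda>v. span {v}) ` C \<noteq> (\<lambda>v. span {v}) ` ?C'" by blast
  then show thesis using that E1 E2 by blast
qed

section \<open>Growth of the number of minimal decompositions\<close>

lemma finite_span_over_finite_field:
  assumes "finite (UNIV :: 'a set)" "finite B"
  shows "finite (span B)"
  using assms(2)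
proof (induction B rule: finite_induct)
  case (insert b B)
  have "span (insert b B) \<subseteq> (\<Union>k. (\<lambda>y. y + scale k b) ` span B)"
    by (auto simp: span_insert image_iff) (metis diff_add_cancel)
  moreover have "finite (\<Union>k. (\<lambda>y. y + scale k b) ` span B)"
    using assms(1) insert.IH by blast
  ultimately show ?case by (rule finite_subset)
qed simp

lemma finite_minimal_decompositions:
  assumes "finite (UNIV :: 'a set)"
  shows "finite {D. minimal_atomic_decomposition S D}"
proof -
  have "finite (UNIV :: 'b set)"
    using finite_span_over_finite_field[OF assms finite_Basis] by (simp add: span_Basis)
  then have "finite (UNIV :: 'b set set set)"
    by (simp add: Finite_Set.finite_set)
  then show ?thesis by (rule finite_subset[rotated]) simp
qed

lemma num_minimal_decompositions_zero: "num_minimal_decompositions {0} = 0"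
  by (simp add: num_minimal_decompositions_def no_minimal_atomic_decomposition_zero)

lemma num_minimal_decompositions_pos:
  assumes "finite (UNIV :: 'a set)" "subspace S" "S \<noteq> {0}"
  shows "num_minimal_decompositions S > 0"
  using minimal_atomic_decomposition_exists[OF assms(2,3)] finite_minimal_decompositions[OF assms(1)]
  by (auto simp: num_minimal_decompositions_def card_gt_0_iff)

text \<open>The two complementary sets of atoms give two injections of the minimal decompositions of the
  smaller subspace into those of the larger one, with disjoint images. The zero subspace needs no
  injection, as its count is zero.\<close>

lemma num_minimal_decompositions_doubles:
  assumes fin: "finite (UNIV :: 'a set)" and S: "subspace S" and T: "subspace T" and "S \<subset> T"
  shows "2 * num_minimal_decompositions S \<le> num_minimal_decompositions T"
proof (cases "S = {0}")
  case True
  then show ?thesis by (simp add: num_minimal_decompositions_zero)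
next
  case False
  obtain E1 E2 where E: "complementary_atoms S T E1" "complementary_atoms S T E2" "E1 \<noteq> E2"
    using two_complementary_sets_of_atoms[OF S False T \<open>S \<subset> T\<close>] .
  let ?M = "\<lambda>S. {D. minimal_atomic_decomposition S D}"
  have inj: "inj_on (\<lambda>(D, E). D \<union> E) (?M S \<times> {E1, E2})"
  proof (rule inj_on_inverseI)
    fix p assume p: "p \<in> ?M S \<times> {E1, E2}"
    obtain D E where DE: "p = (D, E)" by (cases p)
    have "minimal_atomic_decomposition S D" "complementary_atoms S T E"
      using p E(1,2) unfolding DE by blast+
    then show "(\<lambda>F. ({A \<in> F. A \<subseteq> S}, {A \<in> F. \<not> A \<subseteq> S})) ((\<lambda>(D, E). D \<union> E) p) = p"
      using extension_determines_parts[of S D T E] unfolding DE by simp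
  qed
  have "card (?M S \<times> {E1, E2}) \<le> card (?M T)"
    by (rule card_inj_on_le[OF inj _ finite_minimal_decompositions[OF fin]])
      (use E minimal_atomic_decomposition_extend in auto)
  then show ?thesis
    using E(3) by (simp add: num_minimal_decompositions_def card_cartesian_product)
qed

lemma num_minimal_decompositions_strict_mono:
  assumes "finite (UNIV :: 'a set)" "subspace S" "subspace T" "S \<subset> T"
  shows "num_minimal_decompositions S < num_minimal_decompositions T"
proof -
  have "T \<noteq> {0}" using assms(2,4) subspace_0 by blast
  then show ?thesis
    using num_minimal_decompositions_doubles[OF assms] num_minimal_decompositions_pos[OF assms(1,3)]
    by linarith
qed

lemma num_minimal_decompositions_mono:
  assumes "finite (UNIV :: 'a set)" "subspace S" "subspace T" "S \<subseteq> T"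
  shows "num_minimal_decompositions S \<le> num_minimal_decompositions T"
  using num_minimal_decompositions_strict_mono[OF assms(1-3)] assms(4)
  by (cases "S = T") (auto simp: less_imp_le)

text \<open>A strong form of supermodularity: the join of \<open>P\<close> and \<open>Q\<close> may be any common upper bound.\<close>

lemma num_minimal_decompositions_supermodular:
  assumes fin: "finite (UNIV :: 'a set)" and P: "subspace P" "P \<subseteq> T" and Q: "subspace Q" "Q \<subseteq> T"
    and T: "subspace T"
  shows "num_minimal_decompositions P + num_minimal_decompositions Q
    \<le> num_minimal_decompositions T + num_minimal_decompositions (P \<inter> Q)"
proof -
  consider "P \<subseteq> Q" | "Q \<subseteq> P" | "P \<subset> T" "Q \<subset> T" using P(2) Q(2) by blast
  then show ?thesis
  proof cases
    case 1
    then show ?thesis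
      using num_minimal_decompositions_mono[OF fin Q(1) T Q(2)] by (simp add: Int_absorb2)
  next
    case 2
    then show ?thesis
      using num_minimal_decompositions_mono[OF fin P(1) T P(2)] by (simp add: Int_absorb1)
  next
    case 3
    then show ?thesis
      using num_minimal_decompositions_doubles[OF fin P(1) T]
        num_minimal_decompositions_doubles[OF fin Q(1) T] by linarith
  qed
qed

end

section \<open>The metric\<close>

theorem theorem3:
  fixes scale :: "'a::{field,finite} \<Rightarrow> 'b::ab_group_add \<Rightarrow> 'b"
    and Basis :: "'b set"
  assumes "finite_dimensional_vector_space scale Basis"
  shows "Metric_space (vector_space.subspace_lattice scale) (vector_space.atomic_dist scale)"
proof -
  interpret finite_dimensional_vector_space scale Basis by (rule assms)
  have fin: "finite (UNIV :: 'a set)" by simp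
  let ?N = num_minimal_decompositions
  have Int_le: "?N (S \<inter> T) \<le> ?N S" "?N (S \<inter> T) \<le> ?N T" if "subspace S" "subspace T" for S T
    using num_minimal_decompositions_mono[OF fin subspace_inter] that by auto
  show ?thesis
  proof
    fix S T :: "'b set"
    show "0 \<le> atomic_dist S T"
      using Int_le[of S T] by (auto simp: atomic_dist_def subspace_lattice_def)
    show "atomic_dist S T = atomic_dist T S"
      by (auto simp: atomic_dist_def Int_commute)
  next
    fix S T assume "S \<in> subspace_lattice" "T \<in> subspace_lattice"
    then have S: "subspace S" and T: "subspace T" by (auto simp: subspace_lattice_def)
    show "atomic_dist S T = 0 \<longleftrightarrow> S = T"
    proof
      assume "atomic_dist S T = 0"
      then have "?N (S \<inter> T) = ?N S" "?N (S \<inter> T) = ?N T"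
        using Int_le[OF S T] S T by (auto simp: atomic_dist_def subspace_lattice_def)
      then have "\<not> S \<inter> T \<subset> S" "\<not> S \<inter> T \<subset> T"
        using num_minimal_decompositions_strict_mono[OF fin subspace_inter[OF S T]] S T
        by (metis less_irrefl)+
      then show "S = T" by blast
    qed (simp add: atomic_dist_def)
  next
    fix S T U
    assume "S \<in> subspace_lattice" "T \<in> subspace_lattice" "U \<in> subspace_lattice"
    then have S: "subspace S" and T: "subspace T" and U: "subspace U"
      by (auto simp: subspace_lattice_def)
    have "?N (S \<inter> T) + ?N (T \<inter> U) \<le> ?N T + ?N ((S \<inter> T) \<inter> (T \<inter> U))"
      using S T U by (intro num_minimal_decompositions_supermodular[OF fin] subspace_inter) auto
    also have "?N ((S \<inter> T) \<inter> (T \<inter> U)) \<le> ?N (S \<inter> U)"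
      using S T U by (intro num_minimal_decompositions_mono[OF fin] subspace_inter) auto
    finally have "?N (S \<inter> T) + ?N (T \<inter> U) \<le> ?N T + ?N (S \<inter> U)" by simp
    then show "atomic_dist S U \<le> atomic_dist S T + atomic_dist T U"
      using S T U by (simp add: atomic_dist_def subspace_lattice_def)
  qed
qed

end
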